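(* Let $\Omega\subset\mathbb{R}^n$. Each of the following pairs $(F,f)$ satisfies the structure condition (SC) on $\Omega$ (in every case $F$ is assumed continuous and degenerate elliptic). (1) $F(x,r,p,X)=-\operatorname{tr}(X)-\langle W(x),p\rangle-Vr-h(x)$, where $W$ is a bounded continuous vector field, $h$ is a bounded continuous function and $V\in\mathbb{R}$; and $f(s,\varphi,\varphi',\varphi'')=-\varphi''-K|\varphi'|-V\varphi-\omega_h(s)$, where $K=\sup_x|W(x)|$ and $\omega_h$ is a modulus of continuity of $h$. (2) $F(p,X)=-\operatorname{tr}\left[\left(\alpha(|p|)\frac{p\otimes p}{|p|^2}+\beta(|p|)\left(I-\frac{p\otimes p}{|p|^2}\right)\right)X\right]$, where $\alpha,\beta$ are nonnegative functions; and $f(\varphi',\varphi'')=-\alpha(|\varphi'|)\varphi''$. (3) $F(X)$ is uniformly elliptic with constants $0<\lambda\le\Lambda<\infty$, i.e. $-\Lambda\operatorname{tr}(Z)\le F(X+Z)-F(X)\le-\lambda\operatorname{tr}(Z)$ for all $X\in S(n)$ and all $Z\in S(n)$ with $Z\ge0$; and $f(\varphi'')=-\lambda\varphi''$. (4) $F(t,r,p,X)$ (independent of $x$) is proper, i.e. $F(t,r,p,X)\le F(t,v,p,Y)$ whenever $r\le v$ and $Y\le X$; and $f\equiv0$. (5) $F(t,x,r,p,X)$ satisfies, for all $x,y\in\Omega$, $t\in[0,T]$, $v,r\in\mathbb{R}$, $p\in\mathbb{R}^n$ and $X,Z\in S(n)$, $$|F(t,y,r,p,X)-F(t,x,r,p,X)|\le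 L|x-y|,$$ $$F(t,x,r,p,X)-F(t,x,v,p,X)\le K(v-r)\quad\text{for } v\ge r,$$ $$F(t,x,r,p,X+Z)-F(t,x,r,p,X)\le-\lambda(|p|,t)\operatorname{tr}(Z)\quad\text{for } Z\ge0,$$ where $L,K$ are positive constants and $\lambda(\cdot,\cdot)$ is a nonnegative function; and $f(t,s,\varphi,\varphi',\varphi'')=-\lambda(|\varphi'|,t)\varphi''-K\varphi-Ls$.
   Context: $S(n)$ is the set of symmetric $n\times n$ real matrices with its usual order; $p\otimes q$ is the matrix with entries $p_iq_j$. $F:[0,T]\times\Omega\times\mathbb{R}\times\mathbb{R}^n\times S(n)\to\mathbb{R}$ is degenerate elliptic if $F(t,x,r,p,X)\le F(t,x,r,p,Y)$ whenever $Y\le X$. In (2), continuity of $F$ means that the expression, given for $p\neq0$, extends continuously to $p=0$, and $F(0,X)$ denotes this extension. A modulus of continuity of a function $h$ on $\Omega$ is a function $\omega_h$ with $|h(x)-h(y)|\le2\omega_h(|x-y|/2)$ for all $x,y\in\Omega$. Primes denote derivatives in $s$. Structure condition (SC) for $(F,f)$ on $\Omega$: for every smooth function $\varphi=\varphi(s,t)$, $$F\left(t,y,r,\varphi'\tfrac{x-y}{|x-y|},Y\right)-F\left(t,x,v,\varphi'\tfrac{x-y}{|x-y|},X\right)\le -2f(t,s,\varphi,\varphi',\varphi'')$$ for all $t$, all $x,y\in\Omega$ with $|x-y|=2s>0$, all $v,r\in\mathbb{R}$ with $v-r=2\varphi>0$, and all $X,Y\in S(n)$ satisfying $$\begin{pmatrix}X&0\\0&-Y\end{pmatrix}\le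 D^2_{x,y}\left(2\varphi\left(\tfrac{|x-y|}{2},t\right)\right),$$ where $\varphi$ and its derivatives are evaluated at $(s,t)$ with $s=|x-y|/2$, and $D^2_{x,y}$ is the $2n\times 2n$ Hessian in $(x,y)$. Arguments on which $F$ or $f$ does not depend are omitted.
   Formalization: In (2), α(0) in f is read as the limit of α(q) as q→0+ (it exists by continuity of F). With an arbitrary value α(0) the claim fails: n=1, α=β=1 for q>0, α(0)=2, φ'=0, φ''=-1, X=-1, Y=1. If α is continuous at 0 nothing changes. *)

theory Defs
  imports "HOL-Analysis.Analysis"
begin

definition sym_mats :: "(real^'n^'n) set" where
  "sym_mats = {X. transpose X = X}"

text \<open>The usual (Loewner) order on symmetric matrices; the library's \<open>\<le>\<close> on vectors and
  matrices is the componentwise order.\<close>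

definition loewner_le :: "real^'n^'n \<Rightarrow> real^'n^'n \<Rightarrow> bool" (infix "\<preceq>" 50) where
  "X \<preceq> Y \<longleftrightarrow> (\<forall>v. v \<bullet> (X *v v) \<le> v \<bullet> (Y *v v))"

definition tensor :: "real^'n \<Rightarrow> real^'n \<Rightarrow> real^'n^'n" where
  "tensor p q = (\<chi> i j. p $ i * q $ j)"

text \<open>Vectors and matrices on \<open>\<real>\<^sup>n \<times> \<real>\<^sup>n\<close> are indexed by the sum type \<open>'n + 'n\<close>:
  \<open>Inl\<close> for the \<open>x\<close>-coordinates and \<open>Inr\<close> for the \<open>y\<close>-coordinates.\<close>

definition join :: "real^'n \<Rightarrow> real^'n \<Rightarrow> real^('n + 'n)" where
  "join x y = (\<chi> k. case k of Inl i \<Rightarrow> x $ i | Inr i \<Rightarrow> y $ i)"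

definition fst_part :: "real^('n + 'n) \<Rightarrow> real^'n" where
  "fst_part z = (\<chi> i. z $ Inl i)"

definition snd_part :: "real^('n + 'n) \<Rightarrow> real^'n" where
  "snd_part z = (\<chi> i. z $ Inr i)"

definition block_diag :: "real^'n^'n \<Rightarrow> real^'n^'n \<Rightarrow> real^('n + 'n)^('n + 'n)" where
  "block_diag A B = (\<chi> k l. case k of
       Inl i \<Rightarrow> (case l of Inl j \<Rightarrow> A $ i $ j | Inr j \<Rightarrow> 0)
     | Inr i \<Rightarrow> (case l of Inl j \<Rightarrow> 0 | Inr j \<Rightarrow> B $ i $ j))"

definition partial :: "'m \<Rightarrow> (real^'m \<Rightarrow> real) \<Rightarrow> real^'m \<Rightarrow> real" where
  "partial i g z = frechet_derivative g (at z) (axis i 1)"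

definition hessian :: "(real^'m \<Rightarrow> real) \<Rightarrow> real^'m \<Rightarrow> real^'m^'m" where
  "hessian g z = (\<chi> i j. partial i (partial j g) z)"

primrec Ck_on :: "nat \<Rightarrow> 'a::real_normed_vector set \<Rightarrow> ('a \<Rightarrow> real) \<Rightarrow> bool" where
  "Ck_on 0 S g \<longleftrightarrow> continuous_on S g"
| "Ck_on (Suc k) S g \<longleftrightarrow>
     (\<forall>z\<in>S. g differentiable (at z)) \<and> (\<forall>v. Ck_on k S (\<lambda>z. frechet_derivative g (at z) v))"

definition smooth_on :: "'a::real_normed_vector set \<Rightarrow> ('a \<Rightarrow> real) \<Rightarrow> bool" where
  "smooth_on S g \<longleftrightarrow> (\<forall>k. Ck_on k S g)"

text \<open>Operators take the arguments \<open>t x r p X\<close>; only values with \<open>t \<in> [0,T]\<close>, \<open>x \<in> \<Omega>\<close> and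
  symmetric \<open>X\<close> matter.\<close>

type_synonym 'n operator =
  "real \<Rightarrow> real^'n \<Rightarrow> real \<Rightarrow> real^'n \<Rightarrow> real^'n^'n \<Rightarrow> real"

definition continuous_operator :: "real \<Rightarrow> (real^'n) set \<Rightarrow> 'n operator \<Rightarrow> bool" where
  "continuous_operator T \<Omega> F \<longleftrightarrow>
     continuous_on ({0..T} \<times> \<Omega> \<times> UNIV \<times> UNIV \<times> sym_mats) (\<lambda>(t, x, r, p, X). F t x r p X)"

definition degenerate_elliptic :: "real \<Rightarrow> (real^'n) set \<Rightarrow> 'n operator \<Rightarrow> bool" where
  "degenerate_elliptic T \<Omega> F \<longleftrightarrow>
     (\<forall>t\<in>{0..T}. \<forall>x\<in>\<Omega>. \<forall>r p. \<forall>X\<in>sym_mats. \<forall>Y\<in>sym_mats. Y \<preceq> X \<longrightarrow> F t x r p X \<le> F t x r p Y)"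

definition modulus_of_continuity :: "(real^'n) set \<Rightarrow> (real^'n \<Rightarrow> real) \<Rightarrow> (real \<Rightarrow> real) \<Rightarrow> bool" where
  "modulus_of_continuity \<Omega> h \<omega> \<longleftrightarrow> (\<forall>x\<in>\<Omega>. \<forall>y\<in>\<Omega>. \<bar>h x - h y\<bar> \<le> 2 * \<omega> (norm (x - y) / 2))"

text \<open>The structure condition; \<open>f\<close> takes the arguments \<open>t\<close>, \<open>s\<close>, \<open>\<phi>\<close>, \<open>\<phi>'\<close>, \<open>\<phi>''\<close>. The test
  function \<open>\<phi>\<close> is only required to be smooth on some open set \<open>U\<close> containing the point \<open>(s, t)\<close>
  at which the condition is evaluated, so every choice of domain for \<open>\<phi>\<close> is covered.\<close>

definition structure_condition ::
  "real \<Rightarrow> (real^'n) set \<Rightarrow> 'n operator \<Rightarrow> (real \<Rightarrow> real \<Rightarrow> real \<Rightarrow> real \<Rightarrow> real \<Rightarrow> real) \<Rightarrow> bool" where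
  "structure_condition T \<Omega> F f \<longleftrightarrow>
     (\<forall>(\<phi> :: real \<Rightarrow> real \<Rightarrow> real) U. open U \<and> smooth_on U (\<lambda>(s, t). \<phi> s t) \<longrightarrow>
       (\<forall>t\<in>{0..T}. \<forall>x\<in>\<Omega>. \<forall>y\<in>\<Omega>. \<forall>s v r. \<forall>X\<in>sym_mats. \<forall>Y\<in>sym_mats.
         norm (x - y) = 2 * s \<and> s > 0 \<and> (s, t) \<in> U \<and>
         v - r = 2 * \<phi> s t \<and> \<phi> s t > 0 \<and>
         block_diag X (- Y) \<preceq>
           hessian (\<lambda>z. 2 * \<phi> (norm (fst_part z - snd_part z) / 2) t) (join x y)
         \<longrightarrow>
         (let \<phi>1 = deriv (\<lambda>\<sigma>. \<phi> \<sigma> t) s;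
              \<phi>2 = (deriv ^^ 2) (\<lambda>\<sigma>. \<phi> \<sigma> t) s;
              p = \<phi>1 *\<^sub>R ((x - y) /\<^sub>R norm (x - y))
          in F t y r p Y - F t x v p X \<le> - 2 * f t s (\<phi> s t) \<phi>1 \<phi>2)))"

text \<open>A coefficient given for arguments \<open>q > 0\<close>, extended to \<open>q = 0\<close> by its limit. For the operators
  \<open>F(p,X)\<close> that are given for \<open>p \<noteq> 0\<close> and extended continuously to \<open>p = 0\<close>, the value \<open>\<alpha>(0)\<close>
  has to be read in the same way: an unrelated value at \<open>0\<close> is not seen by \<open>F\<close>. Continuity of
  \<open>F\<close> at \<open>p = 0\<close> forces this limit to exist.\<close>

definition ext0 :: "(real \<Rightarrow> real) \<Rightarrow> real \<Rightarrow> real" where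
  "ext0 \<alpha> q = (if q = 0 then Lim (at_right 0) \<alpha> else \<alpha> q)"

end

(* The matrix inequality is tested on two kinds of vectors of R^n x R^n, along which the second
   derivative of 2 phi(|x - y|/2) is immediate. Along (xi, xi) the function is constant, so X <= Y.
   Along (e, -e), with e = (x - y)/|x - y|, it is 2 phi(s + tau), so <e, (Y - X) e> >= -2 phi''.
   As Y - X >= 0, also tr(Y - X) >= <e, (Y - X) e>. These facts give all five cases directly, except
   that (2) at p = 0 is the limit of the inequality at q e as q decreases to 0. *)
theory Submission
  imports Defs
begin

section \<open>Block vectors, traces and rank-one matrices\<close>

lemma join_inner: "join a b \<bullet> join c d = a \<bullet> c + b \<bullet> d"
  unfolding inner_vec_def join_def UNIV_Plus_UNIV[symmetric]
  by (subst sum.Plus) auto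

lemma block_diag_mult_join: "block_diag A B *v join a b = join (A *v a) (B *v b)"
proof -
  have "(\<Sum>j\<in>UNIV. block_diag A B $ k $ j * join a b $ j) = join (A *v a) (B *v b) $ k" for k
    unfolding UNIV_Plus_UNIV[symmetric]
    by (subst sum.Plus) (auto simp: block_diag_def join_def matrix_vector_mult_def split: sum.split)
  then show ?thesis
    by (simp add: vec_eq_iff matrix_vector_mult_def)
qed

lemma fst_part_join [simp]: "fst_part (join x y) = x"
  and snd_part_join [simp]: "snd_part (join x y) = y"
  by (simp_all add: fst_part_def snd_part_def join_def vec_eq_iff)

lemma bounded_linear_part_diff: "bounded_linear (\<lambda>z. fst_part z - snd_part z)"
  unfolding linear_conv_bounded_linear[symmetric]
  by (rule linearI) (auto simp: fst_part_def snd_part_def vec_eq_iff algebra_simps)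

lemma trace_alt: "trace Z = (\<Sum>i\<in>UNIV. axis i 1 \<bullet> (Z *v axis i 1))"
  by (simp add: trace_def inner_axis' matrix_vector_mul_component inner_axis)

lemma trace_ge_quadratic_form:
  fixes Z :: "real^'n^'n"
  assumes Z: "0 \<preceq> Z" and e: "norm e = 1"
  shows "e \<bullet> (Z *v e) \<le> trace Z"
proof -
  (* the sum of the q i \<bullet> Z (q i) is the trace of Z compressed to the orthogonal complement of e *)
  define q where "q i = axis i 1 - e $ i *\<^sub>R e" for i
  have ee: "(\<Sum>i\<in>UNIV. e $ i * e $ i) = 1"
    using e by (simp add: norm_eq_1 inner_vec_def)
  have e_exp: "(\<Sum>i\<in>UNIV. e $ i *\<^sub>R axis i 1) = e"
    by (simp add: vec_eq_iff axis_def if_distrib cong: if_cong)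
  \<comment> \<open>The factors \<open>e $ i\<close> stay attached to the axis vectors so that
    summing over \<open>i\<close> reassembles \<open>e\<close>. The two mixed sums each give
    \<open>e \<bullet> (Z *v e)\<close> with a minus sign, and the last sum gives it once with a
    plus sign since \<open>e\<close> is a unit vector.\<close>
  have "q i \<bullet> (Z *v q i) = axis i 1 \<bullet> (Z *v axis i 1) - (e $ i *\<^sub>R axis i 1) \<bullet> (Z *v e)
      - e \<bullet> (Z *v (e $ i *\<^sub>R axis i 1)) + (e $ i * e $ i) * (e \<bullet> (Z *v e))" for i
    by (simp add: q_def matrix_vector_mult_diff_distrib matrix_vector_mult_scaleR
        inner_diff_left inner_diff_right right_diff_distrib)
  then have "(\<Sum>i\<in>UNIV. q i \<bullet> (Z *v q i)) =
      (\<Sum>i\<in>UNIV. axis i 1 \<bullet> (Z *v axis i 1)) - (\<Sum>i\<in>UNIV. e $ i *\<^sub>R axis i 1) \<bullet> (Z *v e)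
      - e \<bullet> (Z *v (\<Sum>i\<in>UNIV. e $ i *\<^sub>R axis i 1)) + (\<Sum>i\<in>UNIV. e $ i * e $ i) * (e \<bullet> (Z *v e))"
    by (simp only: sum.distrib sum_subtractf inner_sum_left inner_sum_right sum_distrib_right
        linear_sum[OF matrix_vector_mul_linear])
  also have "\<dots> = trace Z - e \<bullet> (Z *v e)"
    by (simp add: ee e_exp trace_alt)
  finally have "trace Z - e \<bullet> (Z *v e) = (\<Sum>i\<in>UNIV. q i \<bullet> (Z *v q i))" ..
  also have "\<dots> \<ge> 0"
    using Z by (intro sum_nonneg) (simp add: loewner_le_def)
  finally show ?thesis by simp
qed

text \<open>Converts the projection onto the gradient direction in the quasilinear operator into the
  quadratic form that the matrix inequality controls.\<close>

lemma trace_tensor_mult: "trace (tensor e e ** X) = e \<bullet> (X *v e)"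
proof -
  have "trace (tensor e e ** X) = (\<Sum>i\<in>UNIV. \<Sum>k\<in>UNIV. e $ k * (X $ k $ i * e $ i))"
    by (simp add: trace_def matrix_matrix_mult_def tensor_def algebra_simps)
  also have "\<dots> = (\<Sum>k\<in>UNIV. \<Sum>i\<in>UNIV. e $ k * (X $ k $ i * e $ i))"
    by (rule sum.swap)
  finally show ?thesis
    by (simp add: inner_vec_def matrix_vector_mult_def sum_distrib_left)
qed

lemma linear_trace_mult: "linear (\<lambda>A :: real^'n^'n. trace (A ** X))"
  by (rule linearI)
    (simp_all add: trace_def matrix_matrix_mult_def sum.distrib sum_distrib_left algebra_simps)

section \<open>Second derivatives along directions and slices\<close>

lemma has_derivative_transform_nhds:
  assumes "(f has_derivative f') (at z)" and "\<forall>\<^sub>F w in nhds z. f w = g w"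
  shows "(g has_derivative f') (at z)"
  by (rule has_derivative_transform_eventually[OF assms(1)])
    (use assms(2) in \<open>simp_all add: eventually_nhds_conv_at\<close>)

text \<open>Linearity in the direction, used for the inner and then for the outer derivative,
  expands the second derivative along \<open>u\<close> into the double sum over Hessian entries. The
  inner derivative is itself differentiated as a function of the point, hence differentiability of
  \<open>g\<close> near \<open>z\<close> and not only at \<open>z\<close>.\<close>

lemma hessian_quadratic_form:
  fixes g :: "real^'m \<Rightarrow> real"
  assumes g1: "\<forall>\<^sub>F w in nhds z. g differentiable (at w)"
    and g2: "\<And>v. (\<lambda>w. frechet_derivative g (at w) v) differentiable (at z)"
  shows "u \<bullet> (hessian g z *v u) =
         frechet_derivative (\<lambda>w. frechet_derivative g (at w) u) (at z) u"
proof -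
  have u_exp: "u = (\<Sum>i\<in>UNIV. u $ i *\<^sub>R axis i 1)"
    by (simp add: vec_eq_iff axis_def if_distrib cong: if_cong)
  have lin_exp: "f u = (\<Sum>i\<in>UNIV. u $ i * f (axis i 1))" if "linear f" for f :: "real^'m \<Rightarrow> real"
    by (subst u_exp) (simp add: linear_sum[OF that] linear_cmul[OF that])
  have D: "((\<lambda>w. partial j g w) has_derivative frechet_derivative (partial j g) (at z)) (at z)" for j
    using g2[of "axis j 1"] by (simp add: partial_def[abs_def] frechet_derivative_works[THEN iffD1])
  have "((\<lambda>w. \<Sum>j\<in>UNIV. u $ j * partial j g w) has_derivative
      (\<lambda>h. \<Sum>j\<in>UNIV. u $ j * frechet_derivative (partial j g) (at z) h)) (at z)"
    by (intro has_derivative_sum has_derivative_mult_right D)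
  moreover have "\<forall>\<^sub>F w in nhds z. (\<Sum>j\<in>UNIV. u $ j * partial j g w) = frechet_derivative g (at w) u"
    using g1 by eventually_elim (simp add: partial_def lin_exp[OF linear_frechet_derivative])
  ultimately have "((\<lambda>w. frechet_derivative g (at w) u) has_derivative
      (\<lambda>h. \<Sum>j\<in>UNIV. u $ j * frechet_derivative (partial j g) (at z) h)) (at z)"
    by (rule has_derivative_transform_nhds)
  from fun_cong[OF frechet_derivative_at[OF this], of u]
  have "frechet_derivative (\<lambda>w. frechet_derivative g (at w) u) (at z) u =
      (\<Sum>j\<in>UNIV. u $ j * frechet_derivative (partial j g) (at z) u)" ..
  also have "\<dots> = (\<Sum>j\<in>UNIV. \<Sum>i\<in>UNIV. u $ i * (partial i (partial j g) z * u $ j))"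
    using D by (simp add: lin_exp[OF has_derivative_linear[OF D]] partial_def[of _ "partial _ g"]
        sum_distrib_left algebra_simps)
  also have "\<dots> = (\<Sum>i\<in>UNIV. \<Sum>j\<in>UNIV. u $ i * (partial i (partial j g) z * u $ j))"
    by (rule sum.swap)
  finally show ?thesis
    by (simp add: inner_vec_def matrix_vector_mult_def hessian_def sum_distrib_left)
qed

text \<open>Passes from Frechet derivatives in two variables to \<open>deriv\<close> in the first
  one: differentiating in \<open>s\<close> with \<open>t\<close> frozen is taking the Frechet
  derivative in direction \<open>(1, 0)\<close>. The first conclusion covers a neighbourhood so that
  its derivative can be differentiated again.\<close>

lemma smooth_on_slice:
  fixes \<phi> :: "real \<Rightarrow> real \<Rightarrow> real"
  assumes U: "open U" "(s, t) \<in> U" and sm: "smooth_on U (\<lambda>(s, t). \<phi> s t)"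
  shows "\<forall>\<^sub>F \<sigma> in nhds s. ((\<lambda>\<sigma>. \<phi> \<sigma> t) has_real_derivative deriv (\<lambda>\<sigma>. \<phi> \<sigma> t) \<sigma>) (at \<sigma>)"
    and "(deriv (\<lambda>\<sigma>. \<phi> \<sigma> t) has_real_derivative (deriv ^^ 2) (\<lambda>\<sigma>. \<phi> \<sigma> t) s) (at s)"
proof -
  define \<Phi> where "\<Phi> = (\<lambda>(s, t). \<phi> s t)"
  define D where "D = (\<lambda>z. frechet_derivative \<Phi> (at z) (1, 0))"
  have "Ck_on (Suc (Suc 0)) U \<Phi>"
    using sm unfolding smooth_on_def \<Phi>_def by blast
  then have d1: "\<Phi> differentiable (at z)" and d2: "D differentiable (at z)" if "z \<in> U" for z
    using that by (auto simp: D_def)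
  \<comment> \<open>Chain rule along the horizontal line through \<open>(\<sigma>, t)\<close>. It is
    stated for general \<open>G\<close> because it serves both for \<open>\<Phi>\<close> and for its
    derivative \<open>D\<close>.\<close>
  have slice: "((\<lambda>\<sigma>. G (\<sigma>, t)) has_real_derivative frechet_derivative G (at (\<sigma>, t)) (1, 0)) (at \<sigma>)"
    if "G differentiable (at (\<sigma>, t))" for G :: "real \<times> real \<Rightarrow> real" and \<sigma>
  proof -
    have G: "(G has_derivative frechet_derivative G (at (\<sigma>, t))) (at (\<sigma>, t))"
      using that by (simp add: frechet_derivative_works)
    have "((\<lambda>\<sigma>. (\<sigma>, t)) has_derivative (\<lambda>h. (h, 0))) (at \<sigma>)"
      by (intro has_derivative_Pair has_derivative_ident has_derivative_const)
    from has_derivative_compose[OF this G]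
    have "((\<lambda>\<sigma>. G (\<sigma>, t)) has_derivative (\<lambda>h. frechet_derivative G (at (\<sigma>, t)) (h, 0))) (at \<sigma>)"
      .
    moreover have "(\<lambda>h. frechet_derivative G (at (\<sigma>, t)) (h, 0)) =
        (*) (frechet_derivative G (at (\<sigma>, t)) (1, 0))"
    proof
      show "frechet_derivative G (at (\<sigma>, t)) (h, 0) = frechet_derivative G (at (\<sigma>, t)) (1, 0) * h" for h
        using linear_cmul[OF has_derivative_linear[OF G], of h "(1, 0)"] by simp
    qed
    ultimately show ?thesis
      by (simp only: has_field_derivative_def)
  qed
  have "((\<lambda>\<sigma>. (\<sigma>, t)) \<longlongrightarrow> (s, t)) (nhds s)"
    by (intro tendsto_intros filterlim_ident)
  then have evU: "\<forall>\<^sub>F \<sigma> in nhds s. (\<sigma>, t) \<in> U"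
    using U by (rule topological_tendstoD)
  have der: "((\<lambda>\<sigma>. \<phi> \<sigma> t) has_real_derivative D (\<sigma>, t)) (at \<sigma>)" if "(\<sigma>, t) \<in> U" for \<sigma>
    using slice[OF d1[OF that]] by (simp add: D_def \<Phi>_def)
  from evU show "\<forall>\<^sub>F \<sigma> in nhds s.
      ((\<lambda>\<sigma>. \<phi> \<sigma> t) has_real_derivative deriv (\<lambda>\<sigma>. \<phi> \<sigma> t) \<sigma>) (at \<sigma>)"
    by eventually_elim (use DERIV_imp_deriv[OF der] der in simp)
  \<comment> \<open>The identity is available only where \<open>(\<sigma>, t)\<close> lies in
    \<open>U\<close>. Agreement near \<open>s\<close> suffices to transfer the derivative.\<close>
  have "\<forall>\<^sub>F \<sigma> in nhds s. deriv (\<lambda>\<sigma>. \<phi> \<sigma> t) \<sigma> = D (\<sigma>, t)"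
    using evU by eventually_elim (rule DERIV_imp_deriv[OF der])
  from DERIV_cong_ev[OF refl this refl, THEN iffD2, OF slice[OF d2[OF U(2)]]]
  have D: "(deriv (\<lambda>\<sigma>. \<phi> \<sigma> t) has_real_derivative
      frechet_derivative D (at (s, t)) (1, 0)) (at s)" .
  with DERIV_imp_deriv[OF D]
  show "(deriv (\<lambda>\<sigma>. \<phi> \<sigma> t) has_real_derivative (deriv ^^ 2) (\<lambda>\<sigma>. \<phi> \<sigma> t) s) (at s)"
    by (simp add: numeral_2_eq_2)
qed

section \<open>The Hessian of a function of the distance\<close>

text \<open>The full matrix is never computed. A closed formula for the first derivative reduces
  each quadratic form to differentiating one scalar function in one direction. The assumption
  \<open>s > 0\<close> keeps the norm away from its singularity.\<close>

lemma distance_hessian: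
  fixes h :: "real \<Rightarrow> real" and x y :: "real^'n"
  assumes h1: "\<forall>\<^sub>F \<sigma> in nhds s. (h has_real_derivative h' \<sigma>) (at \<sigma>)"
    and h2: "(h' has_real_derivative h'') (at s)"
    and s: "norm (x - y) = 2 * s" "s > 0"
  defines "H \<equiv> hessian (\<lambda>z. 2 * h (norm (fst_part z - snd_part z) / 2)) (join x y)"
    and "e \<equiv> sgn (x - y)"
  shows "join \<xi> \<xi> \<bullet> (H *v join \<xi> \<xi>) = 0"
    and "join e (- e) \<bullet> (H *v join e (- e)) = 2 * h''"
proof -
  define L :: "real^('n + 'n) \<Rightarrow> real^'n" where "L z = fst_part z - snd_part z" for z
  define g where "g z = 2 * h (norm (L z) / 2)" for z
  \<comment> \<open>This is the derivative of \<open>g\<close> at \<open>z\<close> along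
    \<open>u\<close>: the gradient of the norm at \<open>L z\<close> is \<open>sgn (L z)\<close>,
    and the factor 2 cancels the halving of the distance.\<close>
  define G where "G u z = h' (norm (L z) / 2) * (L u \<bullet> sgn (L z))" for u z
  define z where "z = join x y"
  have Lz: "L z = x - y" and Lj: "L (join a b) = a - b" for a b
    by (simp_all add: L_def z_def)
  have xy: "x - y \<noteq> 0"
    using s by auto
  have L: "(L has_derivative L) F" for F
    unfolding L_def[abs_def]
    by (rule bounded_linear.has_derivative[OF bounded_linear_part_diff has_derivative_ident])
  have contL: "(L \<longlongrightarrow> L z) (nhds z)"
    using has_derivative_continuous[OF L[of "at z"]]
    by (simp add: isCont_def flip: tendsto_at_iff_tendsto_nhds)
  have Dnorm: "((\<lambda>w. norm (L w) / 2) has_derivative (\<lambda>u. (L u \<bullet> sgn (L w)) / 2)) (at w)"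
    if "L w \<noteq> 0" for w
    using has_derivative_compose[OF L has_derivative_norm[OF that]]
    by (auto intro!: derivative_eq_intros)
  have ev: "\<forall>\<^sub>F w in nhds z. (g has_derivative (\<lambda>u. G u w)) (at w)"
  proof -
    have "((\<lambda>w. norm (L w) / 2) \<longlongrightarrow> s) (nhds z)"
      using tendsto_divide[OF tendsto_norm[OF contL] tendsto_const[of 2]] s by (simp add: Lz)
    then have "\<forall>\<^sub>F w in nhds z. (h has_real_derivative h' (norm (L w) / 2)) (at (norm (L w) / 2))"
      using h1 unfolding filterlim_iff by blast
    moreover have "\<forall>\<^sub>F w in nhds z. L w \<noteq> 0"
      using tendsto_imp_eventually_ne[OF contL] xy by (simp add: Lz)
    ultimately show ?thesis
    proof eventually_elim
      case (elim w)
      have "((\<lambda>w. h (norm (L w) / 2)) has_derivative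
          (\<lambda>u. h' (norm (L w) / 2) * ((L u \<bullet> sgn (L w)) / 2))) (at w)"
        by (rule has_derivative_compose[OF Dnorm[OF elim(2)]])
          (use elim(1) in \<open>simp add: has_field_derivative_def\<close>)
      from has_derivative_mult_right[OF this, of 2] show ?case
        by (simp add: g_def[abs_def] G_def)
    qed
  qed
  have Gdiff: "G u differentiable (at z)" for u
  proof -
    have "(\<lambda>w. norm (L w) / 2) differentiable (at z)"
      using Dnorm[of z] xy by (auto simp: Lz differentiable_def)
    moreover have "h' differentiable (at (norm (L z) / 2))"
      using h2 s by (auto simp: Lz real_differentiable_def)
    ultimately have "(\<lambda>w. h' (norm (L w) / 2)) differentiable (at z)"
      by (rule differentiable_compose[rotated])
    \<comment> \<open>Writing \<open>sgn\<close> as vector over norm gives a quotient of two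
      functions differentiable at \<open>z\<close>, with nonzero denominator there.\<close>
    moreover have "(\<lambda>w. L u \<bullet> sgn (L w)) differentiable (at z)"
    proof -
      have "(\<lambda>w. norm (L w)) differentiable (at z)"
        using has_derivative_compose[OF L has_derivative_norm, of z UNIV] xy
        by (auto simp: Lz differentiable_def)
      moreover have "(\<lambda>w. L u \<bullet> L w) differentiable (at z)"
        using has_derivative_inner_right[OF L] by (auto simp: differentiable_def)
      ultimately have "(\<lambda>w. (L u \<bullet> L w) / norm (L w)) differentiable (at z)"
        using xy by (intro differentiable_divide) (auto simp: Lz)
      then show ?thesis
        by (simp add: sgn_div_norm divide_inverse_commute)
    qed
    ultimately show ?thesis
      unfolding G_def[abs_def] by (rule differentiable_mult)
  qed
  have evG: "\<forall>\<^sub>F w in nhds z. frechet_derivative g (at w) u = G u w" for u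
    using ev by eventually_elim (auto dest!: frechet_derivative_at simp: fun_eq_iff)
  have DG: "((\<lambda>w. frechet_derivative g (at w) u) has_derivative f) (at z)"
    if "(G u has_derivative f) (at z)" for u f
    by (rule has_derivative_transform_nhds[OF that]) (use evG[of u] in \<open>simp add: eq_commute\<close>)
  \<comment> \<open>Any derivative \<open>f\<close> of \<open>G u\<close> at \<open>z\<close> yields
    the quadratic form as \<open>f u\<close>, because \<open>G u\<close> agrees near
    \<open>z\<close> with the first derivative of \<open>g\<close> along \<open>u\<close>.\<close>
  have quad: "u \<bullet> (H *v u) = f u" if "(G u has_derivative f) (at z)" for u f
  proof -
    have "u \<bullet> (hessian g z *v u) = frechet_derivative (\<lambda>w. frechet_derivative g (at w) u) (at z) u"
    proof (rule hessian_quadratic_form)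
      show "\<forall>\<^sub>F w in nhds z. g differentiable (at w)"
        using ev by eventually_elim (auto simp: differentiable_def)
      show "(\<lambda>w. frechet_derivative g (at w) v) differentiable (at z)" for v
        using Gdiff[of v] DG by (auto simp: differentiable_def)
    qed
    also have "\<dots> = f u"
      using frechet_derivative_at[OF DG[OF that]] by simp
    finally show ?thesis
      by (simp add: H_def g_def[abs_def] L_def z_def)
  qed
  have "G (join \<xi> \<xi>) = (\<lambda>w. 0)"
    by (simp add: G_def Lj fun_eq_iff)
  then show "join \<xi> \<xi> \<bullet> (H *v join \<xi> \<xi>) = 0"
    using quad[of "join \<xi> \<xi>" "\<lambda>_. 0"] by simp
  define u where "u = join e (- e)"
  have Lu: "L u = 2 *\<^sub>R e"
    by (simp add: u_def Lj scaleR_2)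
  have e: "norm e = 1" "x - y = (2 * s) *\<^sub>R e"
    using xy s by (simp_all add: e_def norm_sgn sgn_div_norm)
  \<comment> \<open>Only the existence of \<open>f\<close> is known here. Its value at
    \<open>u\<close> is read off by differentiating \<open>G u\<close> along the line
    \<open>z + \<tau> *\<^sub>R u\<close> in two ways.\<close>
  obtain f where f: "(G u has_derivative f) (at z)"
    using Gdiff by (auto simp: differentiable_def)
  have line: "((\<lambda>\<tau>. z + \<tau> *\<^sub>R u) has_derivative (\<lambda>\<tau>. \<tau> *\<^sub>R u)) (at 0)"
    by (auto intro!: derivative_eq_intros)
  have "((\<lambda>\<tau>. G u (z + \<tau> *\<^sub>R u)) has_derivative (\<lambda>\<tau>. f (\<tau> *\<^sub>R u))) (at 0)"
    by (rule has_derivative_compose[OF line]) (use f in simp)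
  moreover have "\<forall>\<^sub>F \<tau> in nhds 0. G u (z + \<tau> *\<^sub>R u) = 2 * h' (s + \<tau>)"
  proof -
    \<comment> \<open>For \<open>\<tau> > - s\<close> the vector
      \<open>L (z + \<tau> *\<^sub>R u)\<close> is still a positive multiple of \<open>e\<close>, so
      its direction is \<open>e\<close> and half its norm is \<open>s + \<tau>\<close>.\<close>
    have "\<forall>\<^sub>F \<tau> in nhds 0. \<tau> \<in> {- s<..}"
      using s by (intro eventually_nhds_in_open) auto
    then show ?thesis
    proof eventually_elim
      case (elim \<tau>)
      have "L (z + \<tau> *\<^sub>R u) = L z + \<tau> *\<^sub>R L u"
        using has_derivative_linear[OF L] by (simp add: linear_add linear_cmul)
      also have "\<dots> = (2 * (s + \<tau>)) *\<^sub>R e"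
        by (simp add: Lz Lu e(2) algebra_simps)
      finally show ?case
        using elim e(1) norm_eq_1[of e]
        by (simp add: G_def Lu sgn_scaleR sgn_div_norm[of e] add_divide_distrib)
    qed
  qed
  ultimately have "((\<lambda>\<tau>. 2 * h' (s + \<tau>)) has_derivative (\<lambda>\<tau>. f (\<tau> *\<^sub>R u))) (at 0)"
    by (rule has_derivative_transform_nhds)
  moreover have "((\<lambda>\<tau>. 2 * h' (s + \<tau>)) has_derivative (\<lambda>\<tau>. 2 * (h'' * \<tau>))) (at 0)"
  proof (rule has_derivative_mult_right)
    have "((\<lambda>\<tau>. h' (s + \<tau>)) has_real_derivative h'') (at 0)"
      using h2 DERIV_shift[of h' h'' 0 s] by (simp add: add.commute)
    then show "((\<lambda>\<tau>. h' (s + \<tau>)) has_derivative (\<lambda>\<tau>. h'' * \<tau>)) (at 0)"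
      by (simp add: has_field_derivative_def)
  qed
  ultimately have "(\<lambda>\<tau>. f (\<tau> *\<^sub>R u)) = (\<lambda>\<tau>. 2 * (h'' * \<tau>))"
    by (rule has_derivative_unique)
  from fun_cong[OF this, of 1] have "f u = 2 * h''"
    by simp
  then show "join e (- e) \<bullet> (H *v join e (- e)) = 2 * h''"
    using quad[OF f] by (simp add: u_def)
qed

section \<open>Reduction of the structure condition to matrix facts\<close>

text \<open>Removes the test function: its value and derivatives become real numbers
  \<open>\<phi>0\<close>, \<open>\<phi>1\<close>, \<open>\<phi>2\<close>, and the block inequality
  is replaced by its two consequences, the order of \<open>X\<close> and \<open>Y\<close> and a
  bound in the direction \<open>e\<close>. All five cases start from here.\<close>

lemma structure_conditionI:
  fixes \<Omega> :: "(real^'n) set"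
  assumes "\<And>t x y s v r X Y e \<phi>0 \<phi>1 \<phi>2.
      \<lbrakk>t \<in> {0..T}; x \<in> \<Omega>; y \<in> \<Omega>; X \<in> sym_mats; Y \<in> sym_mats;
       norm (x - y) = 2 * s; s > 0; v - r = 2 * \<phi>0; \<phi>0 > 0; norm e = 1;
       X \<preceq> Y; e \<bullet> ((Y - X) *v e) \<ge> - 2 * \<phi>2\<rbrakk>
      \<Longrightarrow> F t y r (\<phi>1 *\<^sub>R e) Y - F t x v (\<phi>1 *\<^sub>R e) X \<le> - 2 * f t s \<phi>0 \<phi>1 \<phi>2"
  shows "structure_condition T \<Omega> F f"
  unfolding structure_condition_def
proof (intro allI impI ballI)
  fix \<phi> :: "real \<Rightarrow> real \<Rightarrow> real" and U t x y s v r and X Y :: "real^'n^'n"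
  assume U: "open U \<and> smooth_on U (\<lambda>(s, t). \<phi> s t)"
    and mem: "t \<in> {0..T}" "x \<in> \<Omega>" "y \<in> \<Omega>" "X \<in> sym_mats" "Y \<in> sym_mats"
    and asm: "norm (x - y) = 2 * s \<and> s > 0 \<and> (s, t) \<in> U \<and>
         v - r = 2 * \<phi> s t \<and> \<phi> s t > 0 \<and>
         block_diag X (- Y) \<preceq>
           hessian (\<lambda>z. 2 * \<phi> (norm (fst_part z - snd_part z) / 2) t) (join x y)"
  define \<phi>1 where "\<phi>1 = deriv (\<lambda>\<sigma>. \<phi> \<sigma> t) s"
  define \<phi>2 where "\<phi>2 = (deriv ^^ 2) (\<lambda>\<sigma>. \<phi> \<sigma> t) s"
  define e where "e = sgn (x - y)"
  have neg: "- Y *v a = - (Y *v a)" for a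
    by (simp add: matrix_vector_mult_def vec_eq_iff sum_negf)
  note slice = smooth_on_slice[of U s t \<phi>]
  \<comment> \<open>The block inequality evaluated at \<open>join a b\<close>. It is used with
    \<open>b = a\<close> for the order and with \<open>a = e\<close>, \<open>b = - e\<close> for the
    directional bound.\<close>
  have block: "a \<bullet> (X *v a) - b \<bullet> (Y *v b) \<le>
      join a b \<bullet> (hessian (\<lambda>z. 2 * \<phi> (norm (fst_part z - snd_part z) / 2) t) (join x y) *v join a b)"
    for a b
    using asm unfolding loewner_le_def
    by (elim conjE allE[of _ "join a b"]) (simp add: block_diag_mult_join join_inner neg)
  have hess: "join a a \<bullet> (hessian (\<lambda>z. 2 * \<phi> (norm (fst_part z - snd_part z) / 2) t) (join x y) *v join a a) = 0"
    "join e (- e) \<bullet> (hessian (\<lambda>z. 2 * \<phi> (norm (fst_part z - snd_part z) / 2) t) (join x y) *v join e (- e)) = 2 * \<phi>2"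
    for a
    using distance_hessian[OF slice, of x y] U asm by (auto simp: e_def \<phi>2_def)
  have XY: "X \<preceq> Y"
    unfolding loewner_le_def using block[of a a for a] hess(1) by (metis diff_le_0_iff_le)
  have "(- e) \<bullet> (Y *v (- e)) = e \<bullet> (Y *v e)"
    using matrix_vector_mult_scaleR[of Y "-1" e] by simp
  then have ee: "e \<bullet> ((Y - X) *v e) \<ge> - 2 * \<phi>2"
    using block[of e "- e"] hess(2)
    by (simp add: matrix_vector_mult_diff_rdistrib inner_diff_right)
  have "norm e = 1"
    using asm by (auto simp: e_def norm_sgn)
  with assms[of t x y X Y s v r "\<phi> s t" e \<phi>2 \<phi>1] mem asm XY ee
  have "F t y r (\<phi>1 *\<^sub>R e) Y - F t x v (\<phi>1 *\<^sub>R e) X \<le> - 2 * f t s (\<phi> s t) \<phi>1 \<phi>2"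
    by blast
  then show "let \<phi>1 = deriv (\<lambda>\<sigma>. \<phi> \<sigma> t) s; \<phi>2 = (deriv ^^ 2) (\<lambda>\<sigma>. \<phi> \<sigma> t) s;
              p = \<phi>1 *\<^sub>R ((x - y) /\<^sub>R norm (x - y))
          in F t y r p Y - F t x v p X \<le> - 2 * f t s (\<phi> s t) \<phi>1 \<phi>2"
    by (simp add: Let_def \<phi>1_def \<phi>2_def e_def sgn_div_norm)
qed

lemma sym_mats_diff: "X \<in> sym_mats \<Longrightarrow> Y \<in> sym_mats \<Longrightarrow> X - Y \<in> sym_mats"
  by (simp add: sym_mats_def transpose_def vec_eq_iff)

lemma loewner_le_iff_diff: "X \<preceq> Y \<longleftrightarrow> 0 \<preceq> Y - X"
  by (simp add: loewner_le_def matrix_vector_mult_diff_rdistrib inner_diff_right)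

text \<open>Carries the directional bound over to the trace, for the operators whose ellipticity is
  expressed by a trace.\<close>

lemma trace_diff_ge:
  assumes "X \<preceq> Y" "norm e = 1" "e \<bullet> ((Y - X) *v e) \<ge> c"
  shows "trace (Y - X) \<ge> c"
  using assms trace_ge_quadratic_form[of "Y - X" e] by (simp add: loewner_le_iff_diff[symmetric])

section \<open>The five pairs\<close>

text \<open>The difference splits into four terms, each at most twice its counterpart in
  \<open>- f\<close>: the trace by ellipticity, the drift by Cauchy-Schwarz, the zero-order term
  exactly (so \<open>V\<close> may have either sign), and the source by its modulus at
  \<open>s\<close>, half the distance.\<close>

lemma structure_condition_linear:
  fixes W :: "real^'n \<Rightarrow> real^'n"
  assumes W: "bounded (W ` \<Omega>)" and \<omega>: "modulus_of_continuity \<Omega> h \<omega>"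
  shows "structure_condition T \<Omega> (\<lambda>t x r p X. - trace X - W x \<bullet> p - V * r - h x)
    (\<lambda>t s \<phi> \<phi>1 \<phi>2. - \<phi>2 - (SUP x\<in>\<Omega>. norm (W x)) * \<bar>\<phi>1\<bar> - V * \<phi> - \<omega> s)"
proof (rule structure_conditionI)
  fix t s v r \<phi>0 \<phi>1 \<phi>2 :: real and x y e and X Y :: "real^'n^'n"
  assume mem: "x \<in> \<Omega>" "y \<in> \<Omega>" and s: "norm (x - y) = 2 * s" "s > 0"
    and v: "v - r = 2 * \<phi>0" and e: "norm e = 1"
    and XY: "X \<preceq> Y" "e \<bullet> ((Y - X) *v e) \<ge> - 2 * \<phi>2"
  define K where "K = (SUP x\<in>\<Omega>. norm (W x))"
  \<comment> \<open>Boundedness of \<open>W\<close> makes the supremum a genuine upper bound.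
    \<open>SUP\<close> on the reals gives no such bound for an unbounded set.\<close>
  have "bdd_above ((\<lambda>x. norm (W x)) ` \<Omega>)"
    using W by (auto simp: bounded_iff bdd_above_def)
  then have K: "norm (W a) \<le> K" if "a \<in> \<Omega>" for a
    using that by (auto simp: K_def intro: cSUP_upper)
  have "norm (W x - W y) \<le> 2 * K"
    using norm_triangle_ineq4[of "W x" "W y"] K[OF mem(1)] K[OF mem(2)] by linarith
  then have "norm (W x - W y) * norm (\<phi>1 *\<^sub>R e) \<le> 2 * K * \<bar>\<phi>1\<bar>"
    using e by (simp add: mult_right_mono)
  then have w: "(W x - W y) \<bullet> (\<phi>1 *\<^sub>R e) \<le> 2 * K * \<bar>\<phi>1\<bar>"
    using norm_cauchy_schwarz[of "W x - W y" "\<phi>1 *\<^sub>R e"] by linarith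
  have h: "h x - h y \<le> 2 * \<omega> s"
  proof -
    have "\<bar>h x - h y\<bar> \<le> 2 * \<omega> (norm (x - y) / 2)"
      using \<omega> mem unfolding modulus_of_continuity_def by blast
    then show ?thesis
      using s by simp
  qed
  have "V * v - V * r = 2 * V * \<phi>0"
    using v by (metis mult.left_commute mult.assoc right_diff_distrib)
  then show "- trace Y - W y \<bullet> (\<phi>1 *\<^sub>R e) - V * r - h y -
      (- trace X - W x \<bullet> (\<phi>1 *\<^sub>R e) - V * v - h x)
      \<le> - 2 * (- \<phi>2 - (SUP x\<in>\<Omega>. norm (W x)) * \<bar>\<phi>1\<bar> - V * \<phi>0 - \<omega> s)"
    using w h trace_diff_ge[OF XY(1) e XY(2)]
    by (simp add: K_def[symmetric] trace_sub inner_diff_left algebra_simps)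
qed

text \<open>Along the line spanned by \<open>e\<close> the operator weights
  \<open>e \<bullet> (X *v e)\<close> with \<alpha> and the rest of the trace with \<beta>. For
  \<open>Y - X\<close> that rest is nonnegative, so the \<beta> part only helps, and the \<alpha>
  part is controlled by the directional bound.\<close>

lemma structure_condition_quasilinear:
  fixes \<alpha> \<beta> :: "real \<Rightarrow> real" and F :: "real^'n \<Rightarrow> real^'n^'n \<Rightarrow> real"
  assumes nonneg: "\<And>q. q > 0 \<Longrightarrow> \<alpha> q \<ge> 0 \<and> \<beta> q \<ge> 0"
    and F: "\<And>p X. p \<noteq> 0 \<Longrightarrow> X \<in> sym_mats \<Longrightarrow>
           F p X = - trace ((\<alpha> (norm p) *\<^sub>R (tensor p p /\<^sub>R (norm p)\<^sup>2)
                           + \<beta> (norm p) *\<^sub>R (mat 1 - tensor p p /\<^sub>R (norm p)\<^sup>2)) ** X)"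
    and cont: "continuous_operator T \<Omega> (\<lambda>t x r p X. F p X)"
  shows "structure_condition T \<Omega> (\<lambda>t x r p X. F p X) (\<lambda>t s \<phi> \<phi>1 \<phi>2. - ext0 \<alpha> \<bar>\<phi>1\<bar> * \<phi>2)"
proof (rule structure_conditionI)
  fix t s v r \<phi>0 \<phi>1 \<phi>2 :: real and x y e and X Y :: "real^'n^'n"
  assume mem: "t \<in> {0..T}" "x \<in> \<Omega>" "y \<in> \<Omega>" "X \<in> sym_mats" "Y \<in> sym_mats"
    and e: "norm e = 1"
    and XY: "X \<preceq> Y" "e \<bullet> ((Y - X) *v e) \<ge> - 2 * \<phi>2"
  have val: "F (q *\<^sub>R e) Z = - \<alpha> \<bar>q\<bar> * (e \<bullet> (Z *v e)) - \<beta> \<bar>q\<bar> * (trace Z - e \<bullet> (Z *v e))"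
    if "q \<noteq> 0" "Z \<in> sym_mats" for q Z
  proof -
    \<comment> \<open>Normalising removes both the size and the sign of \<open>q\<close>, so
      negative \<phi>' needs no separate treatment.\<close>
    have "tensor (q *\<^sub>R e) (q *\<^sub>R e) /\<^sub>R (norm (q *\<^sub>R e))\<^sup>2 = tensor e e"
      using that e by (simp add: tensor_def vec_eq_iff power2_eq_square field_simps)
    moreover have "norm (q *\<^sub>R e) = \<bar>q\<bar>"
      using e by simp
    moreover have "q *\<^sub>R e \<noteq> 0"
      using that e by auto
    ultimately have "F (q *\<^sub>R e) Z =
        - trace ((\<alpha> \<bar>q\<bar> *\<^sub>R tensor e e + \<beta> \<bar>q\<bar> *\<^sub>R (mat 1 - tensor e e)) ** Z)"
      using F[of "q *\<^sub>R e" Z] that by (simp only: simp_thms)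
    then show ?thesis
      by (simp add: linear_add[OF linear_trace_mult] linear_diff[OF linear_trace_mult]
          linear_cmul[OF linear_trace_mult] trace_tensor_mult)
  qed
  have tr: "e \<bullet> ((Y - X) *v e) \<le> trace (Y - X)"
    using trace_ge_quadratic_form e XY(1) by (simp add: loewner_le_iff_diff[of X Y])
  have nonzero: "F (q *\<^sub>R e) Y - F (q *\<^sub>R e) X \<le> 2 * \<alpha> \<bar>q\<bar> * \<phi>2" if "q \<noteq> 0" for q
  proof -
    have "\<alpha> \<bar>q\<bar> * (- 2 * \<phi>2) \<le> \<alpha> \<bar>q\<bar> * (e \<bullet> ((Y - X) *v e))"
      using nonneg[of "\<bar>q\<bar>"] that by (intro mult_left_mono XY(2)) auto
    moreover have "0 \<le> \<beta> \<bar>q\<bar> * (trace (Y - X) - e \<bullet> ((Y - X) *v e))"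
      using nonneg[of "\<bar>q\<bar>"] that tr by simp
    ultimately show ?thesis
      by (simp add: val that mem trace_sub matrix_vector_mult_diff_rdistrib inner_diff_right
          right_diff_distrib)
  qed
  show "F (\<phi>1 *\<^sub>R e) Y - F (\<phi>1 *\<^sub>R e) X \<le> - 2 * (- ext0 \<alpha> \<bar>\<phi>1\<bar> * \<phi>2)"
  proof (cases "\<phi>1 = 0")
    case False
    then show ?thesis
      using nonzero[of \<phi>1] by (simp add: ext0_def)
  next
    case True
    \<comment> \<open>Continuity of the operator is restricted to a curve on which only the gradient
      moves; the value 0 in the \<open>r\<close> slot is arbitrary.\<close>
    have lim: "((\<lambda>q. F (q *\<^sub>R e) Z) \<longlongrightarrow> F 0 Z) (at_right 0)" if Z: "Z \<in> sym_mats" for Z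
    proof -
      have "continuous_on UNIV (\<lambda>q. (\<lambda>(t, x, r, p, X). F p X) (t, x, 0 :: real, q *\<^sub>R e, Z))"
        by (rule continuous_on_compose2[OF cont[unfolded continuous_operator_def]])
          (use mem Z in \<open>auto intro!: continuous_intros\<close>)
      then have "isCont (\<lambda>q. F (q *\<^sub>R e) Z) 0"
        by (simp add: continuous_on_eq_continuous_at)
      then show ?thesis
        by (auto simp: isCont_def intro: filterlim_mono at_le)
    qed
    (* the limit of \<alpha> at 0 exists because F (q e) (e \<otimes> e) = - \<alpha> q *)
    define E where "E = tensor e e"
    have E: "E \<in> sym_mats" "trace E = 1" "e \<bullet> (E *v e) = 1"
    proof -
      have ee: "(\<Sum>i\<in>UNIV. e $ i * e $ i) = 1"
        using e by (simp add: norm_eq_1 inner_vec_def)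
      then show "E \<in> sym_mats" "trace E = 1"
        by (simp_all add: E_def sym_mats_def transpose_def tensor_def trace_def vec_eq_iff mult.commute)
      have "E *v e = e"
        using ee by (simp add: E_def tensor_def matrix_vector_mult_def vec_eq_iff mult.assoc
            flip: sum_distrib_left)
      then show "e \<bullet> (E *v e) = 1"
        using e by (simp add: norm_eq_1)
    qed
    have pos: "\<forall>\<^sub>F q in at_right (0 :: real). q > 0"
      by (rule eventually_at_right_less)
    have "((\<lambda>q. - F (q *\<^sub>R e) E) \<longlongrightarrow> - F 0 E) (at_right 0)"
      by (intro tendsto_minus lim E)
    \<comment> \<open>For \<open>E\<close> the trace equals the quadratic form at \<open>e\<close>,
      so the \<beta> term vanishes and \<alpha> is isolated.\<close>
    moreover have "\<forall>\<^sub>F q in at_right 0. - F (q *\<^sub>R e) E = \<alpha> q"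
      using pos
    proof eventually_elim
      case (elim q)
      then show ?case
        using val[of q E] E by simp
    qed
    ultimately have \<alpha>: "(\<alpha> \<longlongrightarrow> - F 0 E) (at_right 0)"
      by (rule Lim_transform_eventually)
    then have ext: "ext0 \<alpha> 0 = - F 0 E"
      by (simp add: ext0_def tendsto_Lim)
    \<comment> \<open>Both sides of \<open>nonzero\<close> converge as \<open>q\<close> decreases to
      0, and the limit of \<alpha> is exactly the value that \<open>ext0\<close> assigns at
      0.\<close>
    have "F 0 Y - F 0 X \<le> 2 * - F 0 E * \<phi>2"
    proof (rule tendsto_le[OF _ _ tendsto_diff[OF lim lim]])
      show "((\<lambda>q. 2 * \<alpha> q * \<phi>2) \<longlongrightarrow> 2 * - F 0 E * \<phi>2) (at_right 0)"
        by (intro tendsto_intros \<alpha>)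
      show "\<forall>\<^sub>F q in at_right 0. F (q *\<^sub>R e) Y - F (q *\<^sub>R e) X \<le> 2 * \<alpha> q * \<phi>2"
        using pos
      proof eventually_elim
        case (elim q)
        then show ?case
          using nonzero[of q] by simp
      qed
    qed (use mem in auto)
    then show ?thesis
      using True ext by simp
  qed
qed

text \<open>The increment \<open>Z = Y - X\<close> is nonnegative, so the upper ellipticity bound
  applies from \<open>X\<close> to \<open>Y\<close>; the lower bound on its trace is then multiplied
  by \<open>- lam < 0\<close>.\<close>

lemma structure_condition_uniformly_elliptic:
  fixes F :: "real^'n^'n \<Rightarrow> real"
  assumes lam: "0 < lam"
    and F: "\<And>X Z. X \<in> sym_mats \<Longrightarrow> Z \<in> sym_mats \<Longrightarrow> 0 \<preceq> Z \<Longrightarrow> F (X + Z) - F X \<le> - lam * trace Z"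
  shows "structure_condition T \<Omega> (\<lambda>t x r p X. F X) (\<lambda>t s \<phi> \<phi>1 \<phi>2. - lam * \<phi>2)"
proof (rule structure_conditionI)
  fix e :: "real^'n" and \<phi>2 :: real and X Y :: "real^'n^'n"
  assume mem: "X \<in> sym_mats" "Y \<in> sym_mats" and e: "norm e = 1"
    and XY: "X \<preceq> Y" "e \<bullet> ((Y - X) *v e) \<ge> - 2 * \<phi>2"
  have "F Y - F X \<le> - lam * trace (Y - X)"
    using F[of X "Y - X"] mem XY by (simp add: sym_mats_diff loewner_le_iff_diff[of X Y])
  also have "\<dots> \<le> - lam * (- 2 * \<phi>2)"
    using trace_diff_ge[OF XY(1) e XY(2)] lam by (intro mult_left_mono_neg) auto
  finally show "F Y - F X \<le> - 2 * (- lam * \<phi>2)" by simp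
qed

text \<open>The gradient is the same on both sides, \<open>r < v\<close> since \<phi> is positive,
  and \<open>X \<preceq> Y\<close>, so properness with the matrices exchanged makes the difference
  nonpositive.\<close>

lemma structure_condition_proper:
  fixes F :: "real \<Rightarrow> real \<Rightarrow> real^'n \<Rightarrow> real^'n^'n \<Rightarrow> real"
  assumes F: "\<And>t r v p X Y. t \<in> {0..T} \<Longrightarrow> X \<in> sym_mats \<Longrightarrow> Y \<in> sym_mats \<Longrightarrow>
      r \<le> v \<Longrightarrow> Y \<preceq> X \<Longrightarrow> F t r p X \<le> F t v p Y"
  shows "structure_condition T \<Omega> (\<lambda>t x r p X. F t r p X) (\<lambda>t s \<phi> \<phi>1 \<phi>2. 0)"
  by (rule structure_conditionI) (auto intro!: F)

text \<open>Telescopes from \<open>(y, r, Y)\<close> through \<open>(x, r, Y)\<close> and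
  \<open>(x, v, Y)\<close> to \<open>(x, v, X)\<close>, changing one argument at a time. The three
  increments produce the terms with \<open>L\<close>, \<open>K\<close> and \<open>lam\<close>, and
  \<open>norm e = 1\<close> turns the norm of the gradient into
  \<open>\<bar>\<phi>1\<bar>\<close>.\<close>

lemma structure_condition_lipschitz:
  fixes F :: "('n :: finite) operator"
  assumes lam: "\<And>q t. q \<ge> 0 \<Longrightarrow> t \<in> {0..T} \<Longrightarrow> lam q t \<ge> 0"
    and Fx: "\<And>x y t r p X. x \<in> \<Omega> \<Longrightarrow> y \<in> \<Omega> \<Longrightarrow> t \<in> {0..T} \<Longrightarrow> X \<in> sym_mats \<Longrightarrow>
           \<bar>F t y r p X - F t x r p X\<bar> \<le> L * norm (x - y)"
    and Fr: "\<And>x t v r p X. x \<in> \<Omega> \<Longrightarrow> t \<in> {0..T} \<Longrightarrow> X \<in> sym_mats \<Longrightarrow> v \<ge> r \<Longrightarrow>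
           F t x r p X - F t x v p X \<le> K * (v - r)"
    and FX: "\<And>x t r p X Z. x \<in> \<Omega> \<Longrightarrow> t \<in> {0..T} \<Longrightarrow> X \<in> sym_mats \<Longrightarrow> Z \<in> sym_mats \<Longrightarrow>
           0 \<preceq> Z \<Longrightarrow> F t x r p (X + Z) - F t x r p X \<le> - lam (norm p) t * trace Z"
  shows "structure_condition T \<Omega> F (\<lambda>t s \<phi> \<phi>1 \<phi>2. - lam \<bar>\<phi>1\<bar> t * \<phi>2 - K * \<phi> - L * s)"
proof (rule structure_conditionI)
  fix t s v r \<phi>0 \<phi>1 \<phi>2 :: real and x y e and X Y :: "real^'n^'n"
  assume mem: "t \<in> {0..T}" "x \<in> \<Omega>" "y \<in> \<Omega>" "X \<in> sym_mats" "Y \<in> sym_mats"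
    and s: "norm (x - y) = 2 * s" and v: "v - r = 2 * \<phi>0" "\<phi>0 > 0" and e: "norm e = 1"
    and XY: "X \<preceq> Y" "e \<bullet> ((Y - X) *v e) \<ge> - 2 * \<phi>2"
  let ?p = "\<phi>1 *\<^sub>R e"
  have "F t x v ?p Y - F t x v ?p X \<le> - lam \<bar>\<phi>1\<bar> t * trace (Y - X)"
    using FX[of x t X "Y - X" v ?p] mem XY e by (simp add: sym_mats_diff loewner_le_iff_diff[of X Y])
  also have "\<dots> \<le> - lam \<bar>\<phi>1\<bar> t * (- 2 * \<phi>2)"
    using trace_diff_ge[OF XY(1) e XY(2)] lam[of "\<bar>\<phi>1\<bar>" t] mem
    by (intro mult_left_mono_neg) auto
  finally have "F t x v ?p Y - F t x v ?p X \<le> 2 * (lam \<bar>\<phi>1\<bar> t * \<phi>2)"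
    by simp
  moreover have "F t y r ?p Y - F t x r ?p Y \<le> 2 * (L * s)"
    using Fx[of x y t Y r ?p] mem s by simp
  moreover have "F t x r ?p Y - F t x v ?p Y \<le> 2 * (K * \<phi>0)"
    using Fr[of x t Y r v ?p] mem v by simp
  ultimately show "F t y r ?p Y - F t x v ?p X \<le> - 2 * (- lam \<bar>\<phi>1\<bar> t * \<phi>2 - K * \<phi>0 - L * s)"
    by simp
qed

theorem proposition1p1:
  fixes T :: real and \<Omega> :: "(real^'n) set"
  shows
    "(\<forall>(W :: real^'n \<Rightarrow> real^'n) (V :: real) (h :: real^'n \<Rightarrow> real) (\<omega> :: real \<Rightarrow> real) F.
        continuous_on \<Omega> W \<and> bounded (W ` \<Omega>) \<and> continuous_on \<Omega> h \<and> bounded (h ` \<Omega>) \<and>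
        modulus_of_continuity \<Omega> h \<omega> \<and>
        F = (\<lambda>t x r p X. - trace X - W x \<bullet> p - V * r - h x) \<and>
        continuous_operator T \<Omega> F \<and> degenerate_elliptic T \<Omega> F
        \<longrightarrow> structure_condition T \<Omega> F
              (\<lambda>t s \<phi> \<phi>1 \<phi>2. - \<phi>2 - (SUP x\<in>\<Omega>. norm (W x)) * \<bar>\<phi>1\<bar> - V * \<phi> - \<omega> s))
   \<and>
     (\<forall>(\<alpha> :: real \<Rightarrow> real) (\<beta> :: real \<Rightarrow> real) (F :: real^'n \<Rightarrow> real^'n^'n \<Rightarrow> real).
        (\<forall>q>0. \<alpha> q \<ge> 0 \<and> \<beta> q \<ge> 0) \<and>
        (\<forall>p X. p \<noteq> 0 \<and> X \<in> sym_mats \<longrightarrow>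
           F p X = - trace ((\<alpha> (norm p) *\<^sub>R (tensor p p /\<^sub>R (norm p)\<^sup>2)
                           + \<beta> (norm p) *\<^sub>R (mat 1 - tensor p p /\<^sub>R (norm p)\<^sup>2)) ** X)) \<and>
        continuous_operator T \<Omega> (\<lambda>t x r p X. F p X) \<and>
        degenerate_elliptic T \<Omega> (\<lambda>t x r p X. F p X)
        \<longrightarrow> structure_condition T \<Omega> (\<lambda>t x r p X. F p X)
              (\<lambda>t s \<phi> \<phi>1 \<phi>2. - ext0 \<alpha> \<bar>\<phi>1\<bar> * \<phi>2))
   \<and>
     (\<forall>(lam :: real) (Lam :: real) (F :: real^'n^'n \<Rightarrow> real).
        0 < lam \<and> lam \<le> Lam \<and>
        (\<forall>X\<in>sym_mats. \<forall>Z\<in>sym_mats. 0 \<preceq> Z \<longrightarrow>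
           - Lam * trace Z \<le> F (X + Z) - F X \<and> F (X + Z) - F X \<le> - lam * trace Z) \<and>
        continuous_operator T \<Omega> (\<lambda>t x r p X. F X) \<and>
        degenerate_elliptic T \<Omega> (\<lambda>t x r p X. F X)
        \<longrightarrow> structure_condition T \<Omega> (\<lambda>t x r p X. F X) (\<lambda>t s \<phi> \<phi>1 \<phi>2. - lam * \<phi>2))
   \<and>
     (\<forall>F :: real \<Rightarrow> real \<Rightarrow> real^'n \<Rightarrow> real^'n^'n \<Rightarrow> real.
        (\<forall>t\<in>{0..T}. \<forall>r v p. \<forall>X\<in>sym_mats. \<forall>Y\<in>sym_mats.
           r \<le> v \<and> Y \<preceq> X \<longrightarrow> F t r p X \<le> F t v p Y) \<and>
        continuous_operator T \<Omega> (\<lambda>t x r p X. F t r p X) \<and>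
        degenerate_elliptic T \<Omega> (\<lambda>t x r p X. F t r p X)
        \<longrightarrow> structure_condition T \<Omega> (\<lambda>t x r p X. F t r p X) (\<lambda>t s \<phi> \<phi>1 \<phi>2. 0))
   \<and>
     (\<forall>(L :: real) (K :: real) (lam :: real \<Rightarrow> real \<Rightarrow> real) (F :: 'n operator).
        L > 0 \<and> K > 0 \<and> (\<forall>q\<ge>0. \<forall>t\<in>{0..T}. lam q t \<ge> 0) \<and>
        (\<forall>x\<in>\<Omega>. \<forall>y\<in>\<Omega>. \<forall>t\<in>{0..T}. \<forall>r p. \<forall>X\<in>sym_mats.
           \<bar>F t y r p X - F t x r p X\<bar> \<le> L * norm (x - y)) \<and>
        (\<forall>x\<in>\<Omega>. \<forall>t\<in>{0..T}. \<forall>v r p. \<forall>X\<in>sym_mats.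
           v \<ge> r \<longrightarrow> F t x r p X - F t x v p X \<le> K * (v - r)) \<and>
        (\<forall>x\<in>\<Omega>. \<forall>t\<in>{0..T}. \<forall>r p. \<forall>X\<in>sym_mats. \<forall>Z\<in>sym_mats.
           0 \<preceq> Z \<longrightarrow> F t x r p (X + Z) - F t x r p X \<le> - lam (norm p) t * trace Z) \<and>
        continuous_operator T \<Omega> F \<and> degenerate_elliptic T \<Omega> F
        \<longrightarrow> structure_condition T \<Omega> F
              (\<lambda>t s \<phi> \<phi>1 \<phi>2. - lam \<bar>\<phi>1\<bar> t * \<phi>2 - K * \<phi> - L * s))"
  apply (intro conjI allI impI)
      apply (simp add: structure_condition_linear)
     apply (rule structure_condition_quasilinear; simp)
    apply (elim conjE, rule structure_condition_uniformly_elliptic; blast)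
   apply (elim conjE, rule structure_condition_proper; blast)
  apply (elim conjE, rule structure_condition_lipschitz; simp only:)
  done

end
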